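(* Let $\Delta$ and $\Gamma$ be finite simplicial graphs with $V(\Delta)=\{x_1,\dots,x_n\}$ and $V(\Gamma)=\{y_1,\dots,y_M\}$, and let $K$ be the number of connected components of $\Delta$. Put $R=4Kn^2M^{K+1}$. If $\Delta$ is an induced subgraph of the extension graph $\Gamma^e$, then $\Delta$ is an induced subgraph of $B(\Gamma^e,R)$, the induced subgraph of $\Gamma^e$ spanned by the finite vertex set $\{v y_i v^{-1} \mid 1\le i\le M,\ v\in\mathbb{G}(\Gamma),\ |v|\le R\}$.
   Context: For a finite simplicial graph $\Gamma$, the partially commutative group (right-angled Artin group) is $\mathbb{G}(\Gamma)=\langle V(\Gamma)\mid [x,y]=1 \text{ for } (x,y)\in E(\Gamma)\rangle$. $|v|$ denotes the word length of $v$ with respect to the generating set $V(\Gamma)$. The extension graph $\Gamma^e$ has as vertices all conjugates $g^{-1}xg$ ($x\in V(\Gamma)$, $g\in\mathbb{G}(\Gamma)$) of generators, with an edge between two distinct vertices iff they commute in $\mathbb{G}(\Gamma)$. $\Lambda$ is an induced subgraph of $\Gamma$ if there is an injective map $i:V(\Lambda)\to V(\Gamma)$ with $(v,v')\in E(\Lambda)$ iff $(i(v),i(v'))\in E(\Gamma)$. *)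

theory Defs
  imports Main
begin

definition simple_graph :: "'a set \<Rightarrow> ('a \<Rightarrow> 'a \<Rightarrow> bool) \<Rightarrow> bool" where
  "simple_graph V E \<longleftrightarrow> finite V \<and> (\<forall>x y. E x y \<longrightarrow> x \<in> V \<and> y \<in> V)
     \<and> (\<forall>x y. E x y \<longrightarrow> E y x) \<and> (\<forall>x. \<not> E x x)"

text \<open>Words over the generators: a letter (x, True) is x, a letter (x, False) is x^{-1}.\<close>

type_synonym 'a word = "('a \<times> bool) list"

definition words_over :: "'a set \<Rightarrow> 'a word set" where
  "words_over V = {w. \<forall>l \<in> set w. fst l \<in> V}"

definition inv_word :: "'a word \<Rightarrow> 'a word" where
  "inv_word w = rev (map (\<lambda>(x, b). (x, \<not> b)) w)"

inductive raag_step :: "('a \<Rightarrow> 'a \<Rightarrow> bool) \<Rightarrow> 'a word \<Rightarrow> 'a word \<Rightarrow> bool"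
  for E where
  cancel: "raag_step E (u @ [(x, b), (x, \<not> b)] @ w) (u @ w)"
| commute: "E x y \<Longrightarrow> raag_step E (u @ [(x, b), (y, c)] @ w) (u @ [(y, c), (x, b)] @ w)"

definition raag_eq :: "('a \<Rightarrow> 'a \<Rightarrow> bool) \<Rightarrow> 'a word \<Rightarrow> 'a word \<Rightarrow> bool" where
  "raag_eq E = equivclp (raag_step E)"

definition word_length :: "'a set \<Rightarrow> ('a \<Rightarrow> 'a \<Rightarrow> bool) \<Rightarrow> 'a word \<Rightarrow> nat" where
  "word_length V E w = (LEAST k. \<exists>u \<in> words_over V. length u = k \<and> raag_eq E u w)"

definition ext_vertex :: "'a set \<Rightarrow> ('a \<Rightarrow> 'a \<Rightarrow> bool) \<Rightarrow> 'a word \<Rightarrow> bool" where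
  "ext_vertex V E c \<longleftrightarrow>
     (\<exists>g \<in> words_over V. \<exists>x \<in> V. raag_eq E c (inv_word g @ [(x, True)] @ g))"

definition commutes :: "('a \<Rightarrow> 'a \<Rightarrow> bool) \<Rightarrow> 'a word \<Rightarrow> 'a word \<Rightarrow> bool" where
  "commutes E c d \<longleftrightarrow> raag_eq E (c @ d) (d @ c)"

definition ball_vertex :: "'a set \<Rightarrow> ('a \<Rightarrow> 'a \<Rightarrow> bool) \<Rightarrow> nat \<Rightarrow> 'a word \<Rightarrow> bool" where
  "ball_vertex V E R c \<longleftrightarrow>
     (\<exists>v \<in> words_over V. \<exists>y \<in> V. word_length V E v \<le> R
        \<and> raag_eq E c (v @ [(y, True)] @ inv_word v))"

text \<open>Delta (vertex set VD, edges ED) is an induced subgraph of the subgraph of Gamma^e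
induced on the vertices satisfying P. Vertices of Gamma^e are group elements, so
injectivity is modulo equality in G(Gamma); two distinct vertices are adjacent iff they commute.\<close>
definition induced_in_ext ::
  "'b set \<Rightarrow> ('b \<Rightarrow> 'b \<Rightarrow> bool) \<Rightarrow> ('a \<Rightarrow> 'a \<Rightarrow> bool) \<Rightarrow> ('a word \<Rightarrow> bool) \<Rightarrow> bool" where
  "induced_in_ext VD ED E P \<longleftrightarrow>
     (\<exists>f :: 'b \<Rightarrow> 'a word.
        (\<forall>a \<in> VD. P (f a))
      \<and> (\<forall>a \<in> VD. \<forall>b \<in> VD. a \<noteq> b \<longrightarrow> \<not> raag_eq E (f a) (f b))
      \<and> (\<forall>a \<in> VD. \<forall>b \<in> VD. a \<noteq> b \<longrightarrow> (ED a b \<longleftrightarrow> commutes E (f a) (f b))))"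

definition num_components :: "'b set \<Rightarrow> ('b \<Rightarrow> 'b \<Rightarrow> bool) \<Rightarrow> nat" where
  "num_components V E = card (V // {(a, b). a \<in> V \<and> b \<in> V \<and>
      (\<lambda>x y. x \<in> V \<and> y \<in> V \<and> E x y)\<^sup>*\<^sup>* a b})"

end

theory Submission
  imports Defs "HOL-Library.Sublist"
begin

text \<open>
  A vertex \<open>g x g\<inverse>\<close> of the extension graph is the coset of \<open>\<langle>St(x)\<rangle>\<close> through \<open>g\<close>, and two vertices
  commute iff their types are equal or adjacent and their cosets meet. Attach a weight to every hyperplane
  of the universal cover of the Salvetti complex and replace each letter of a path by its power with
  exponent the weight of the hyperplane it crosses. This is well defined on group elements and maps
  meeting cosets to meeting cosets, so it preserves adjacency.

  If two cosets of adjacent or equal types do not meet, a shortest path between them contains a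
  subword that is a walk of distinct types in the complement graph leading out of both stars. The
  signed number of occurrences of such a pattern is a group invariant that vanishes on the product
  of the two star subgroups. On the reweighted path it is a multiaffine polynomial of degree at most
  \<open>M\<close> in the weights, and it is nonzero because one may keep exactly the hyperplanes of the walk.
  Hence there are weights of total size at most \<open>n\<^sup>2M\<close> at which none of these polynomials vanishes,
  and a geodesic crosses every hyperplane at most once, so conjugators of length \<open>n\<^sup>2M\<close> suffice.
\<close>

section \<open>Nonvanishing of multiaffine polynomials\<close>

text \<open>\<open>L\<close> holds the variables that may occur and \<open>d\<close> bounds the
  degree. The condition \<open>h \<notin> L\<close> in rule \<open>var\<close> keeps every variable
  at exponent at most one.\<close>

inductive multiaffine :: "'k set \<Rightarrow> nat \<Rightarrow> (('k \<Rightarrow> nat) \<Rightarrow> int) \<Rightarrow> bool" where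
  const: "multiaffine L d (\<lambda>_. r)"
| add: "multiaffine L d F \<Longrightarrow> multiaffine L d G \<Longrightarrow> multiaffine L d (\<lambda>c. F c + G c)"
| var: "multiaffine L d F \<Longrightarrow> h \<notin> L \<Longrightarrow> multiaffine (insert h L) (Suc d) (\<lambda>c. int (c h) * r * F c)"
| mono: "multiaffine L d F \<Longrightarrow> L \<subseteq> L' \<Longrightarrow> d \<le> d' \<Longrightarrow> multiaffine L' d' F"

lemma multiaffine_cong:
  "multiaffine L d F \<Longrightarrow> \<forall>h\<in>L. c h = c' h \<Longrightarrow> F c = F c'"
  by (induction rule: multiaffine.induct) auto

text \<open>Isolates the variable \<open>h\<close>: the slope \<open>B\<close> has lost one degree.
  Since \<open>d - 1\<close> is truncated, the last conjunct settles degree zero.\<close>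

lemma multiaffine_split:
  "multiaffine L d F \<Longrightarrow> \<exists>A B. (\<forall>c. F c = A c + int (c h) * B c) \<and>
     multiaffine (L - {h}) d A \<and> multiaffine (L - {h}) (d - 1) B \<and> (d = 0 \<longrightarrow> B = (\<lambda>_. 0))"
proof (induction rule: multiaffine.induct)
  case (const L d r)
  show ?case
    by (rule exI[of _ "\<lambda>_. r"], rule exI[of _ "\<lambda>_. 0"]) (auto intro: multiaffine.const)
next
  case (add L d F G)
  obtain A B where "\<forall>c. F c = A c + int (c h) * B c"
    "multiaffine (L - {h}) d A" "multiaffine (L - {h}) (d - 1) B" "d = 0 \<longrightarrow> B = (\<lambda>_. 0)"
    using add.IH(1) by (elim exE conjE) (rule that)
  moreover obtain A' B' where "\<forall>c. G c = A' c + int (c h) * B' c"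
    "multiaffine (L - {h}) d A'" "multiaffine (L - {h}) (d - 1) B'" "d = 0 \<longrightarrow> B' = (\<lambda>_. 0)"
    using add.IH(2) by (elim exE conjE) (rule that)
  ultimately show ?case
    by (intro exI[of _ "\<lambda>c. A c + A' c"] exI[of _ "\<lambda>c. B c + B' c"])
      (auto simp: algebra_simps intro: multiaffine.add)
next
  case (var L d F h' r)
  show ?case
  proof (cases "h' = h")
    case True
    have "multiaffine L d (\<lambda>c. r * F c)"
      using var(1)
    proof (induction rule: multiaffine.induct)
      case (add L d F G)
      then show ?case using multiaffine.add[OF add.IH] by (simp add: algebra_simps)
    next
      case (var L d F h s)
      then show ?case using multiaffine.var[OF var(1,2), of "r * s"] by (simp add: algebra_simps)
    qed (auto intro: multiaffine.const multiaffine.mono)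
    then show ?thesis
      using True var(2)
      by (intro exI[of _ "\<lambda>_. 0"] exI[of _ "\<lambda>c. r * F c"]) (auto intro: multiaffine.const)
  next
    case False
    obtain A B where AB: "\<forall>c. F c = A c + int (c h) * B c" "multiaffine (L - {h}) d A"
      "multiaffine (L - {h}) (d - 1) B" "d = 0 \<longrightarrow> B = (\<lambda>_. 0)"
      using var.IH by (elim exE conjE) (rule that)
    have L: "insert h' L - {h} = insert h' (L - {h})" using False by auto
    have "multiaffine (insert h' (L - {h})) (Suc d) (\<lambda>c. int (c h') * r * A c)"
      using AB(2) var(2) by (intro multiaffine.var) auto
    moreover have "multiaffine (insert h' (L - {h})) d (\<lambda>c. int (c h') * r * B c)"
    proof (cases d)
      case 0
      then show ?thesis using AB(4) by (simp add: multiaffine.const)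
    next
      case (Suc d')
      then show ?thesis using multiaffine.var[of "L - {h}" d' B h' r] AB(3) var(2) by simp
    qed
    ultimately show ?thesis
      using AB(1) unfolding L
      by (intro exI[of _ "\<lambda>c. int (c h') * r * A c"] exI[of _ "\<lambda>c. int (c h') * r * B c"])
        (auto simp: algebra_simps)
  qed
next
  case (mono L d F L' d')
  obtain A B where AB: "\<forall>c. F c = A c + int (c h) * B c" "multiaffine (L - {h}) d A"
      "multiaffine (L - {h}) (d - 1) B" "d = 0 \<longrightarrow> B = (\<lambda>_. 0)"
    using mono.IH by (elim exE conjE) (rule that)
  then have "multiaffine (L' - {h}) d' A" "multiaffine (L' - {h}) (d' - 1) B"
    using mono by (auto intro: multiaffine.mono[of "L - {h}" d] multiaffine.mono[of "L - {h}" "d - 1"])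
  then show ?case using AB mono(3) by auto
qed

text \<open>For each function, the leading coefficient with respect to the last variable is made nonzero
first; then a function excludes at most one value of that variable, and only if its degree drops.\<close>

lemma multiaffine_nonvanishing:
  assumes "finite L" "finite P"
    and "\<And>p. p \<in> P \<Longrightarrow> multiaffine L (d p) (F p)"
    and "\<And>p. p \<in> P \<Longrightarrow> \<exists>c. F p c \<noteq> 0"
  shows "\<exists>c. (\<forall>h. h \<notin> L \<longrightarrow> c h = 0) \<and> (\<forall>p\<in>P. F p c \<noteq> 0) \<and> sum c L \<le> sum d P"
  using assms(1,3,4)
proof (induction L arbitrary: d F rule: finite_induct)
  case empty
  have "F p (\<lambda>_. 0) \<noteq> 0" if p: "p \<in> P" for p
  proof -
    obtain c where "F p c \<noteq> 0" using empty(2) p by blast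
    then show ?thesis using multiaffine_cong[OF empty(1)[OF p], of c "\<lambda>_. 0"] by simp
  qed
  then show ?case by (intro exI[of _ "\<lambda>_. 0"]) auto
next
  case (insert h L)
  have "\<forall>p\<in>P. \<exists>A B. (\<forall>c. F p c = A c + int (c h) * B c) \<and>
     multiaffine L (d p) A \<and> multiaffine L (d p - 1) B \<and> (d p = 0 \<longrightarrow> B = (\<lambda>_. 0))"
    using multiaffine_split[OF insert.prems(1), of _ h] insert.hyps by simp
  from bchoice[OF this] obtain A where "\<forall>p\<in>P. \<exists>B. (\<forall>c. F p c = A p c + int (c h) * B c) \<and>
     multiaffine L (d p) (A p) \<and> multiaffine L (d p - 1) B \<and> (d p = 0 \<longrightarrow> B = (\<lambda>_. 0))" ..
  from bchoice[OF this] obtain B where "\<forall>p\<in>P. (\<forall>c. F p c = A p c + int (c h) * B p c) \<and>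
     multiaffine L (d p) (A p) \<and> multiaffine L (d p - 1) (B p) \<and> (d p = 0 \<longrightarrow> B p = (\<lambda>_. 0))" ..
  then have AB: "\<And>p c. p \<in> P \<Longrightarrow> F p c = A p c + int (c h) * B p c"
    "\<And>p. p \<in> P \<Longrightarrow> multiaffine L (d p) (A p)" "\<And>p. p \<in> P \<Longrightarrow> multiaffine L (d p - 1) (B p)"
    "\<And>p. p \<in> P \<Longrightarrow> d p = 0 \<Longrightarrow> B p = (\<lambda>_. 0)"
    by simp_all
  \<comment> \<open>\<open>Q\<close> collects the functions that really depend on \<open>h\<close>.
    For these the slope is made nonzero, for the others the part free of \<open>h\<close>.\<close>
  define Q where "Q = {p \<in> P. \<exists>c. B p c \<noteq> 0}"
  have Q: "Q \<subseteq> P" "finite Q" using \<open>finite P\<close> by (auto simp: Q_def)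
  define d' where "d' p = (if p \<in> Q then d p - 1 else d p)" for p
  have "\<exists>c. (\<forall>h. h \<notin> L \<longrightarrow> c h = 0) \<and> (\<forall>p\<in>P. (if p \<in> Q then B p else A p) c \<noteq> 0) \<and> sum c L \<le> sum d' P"
  proof (rule insert.IH)
    fix p assume p: "p \<in> P"
    show "multiaffine L (d' p) (if p \<in> Q then B p else A p)" using AB p by (auto simp: d'_def)
    show "\<exists>c. (if p \<in> Q then B p else A p) c \<noteq> 0"
    proof (cases "p \<in> Q")
      case False
      obtain c where "F p c \<noteq> 0" using insert.prems(2) p by blast
      then show ?thesis using AB(1)[OF p, of c] False p by (auto simp: Q_def)
    qed (auto simp: Q_def)
  qed
  then obtain c where c: "\<forall>h. h \<notin> L \<longrightarrow> c h = 0"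
    "\<forall>p\<in>P. (if p \<in> Q then B p else A p) c \<noteq> 0" "sum c L \<le> sum d' P"
    by (elim exE conjE) (rule that)
  have B0: "B p c \<noteq> 0" if "p \<in> Q" for p using c(2) Q(1) that by fastforce
  have A0: "A p c \<noteq> 0" if "p \<in> P" "p \<notin> Q" for p using c(2) that by fastforce
  \<comment> \<open>Once the other weights are fixed, \<open>- A p c / B p c\<close> is the only
    possible root in \<open>h\<close>. Rounding by \<open>div\<close> and \<open>nat\<close> can
    only exclude further values, still one per function, so one of \<open>card Q + 1\<close>
    candidates survives.\<close>
  define Z where "Z = (\<lambda>p. nat (- (A p c div B p c))) ` Q"
  have "finite Z" "card Z < card {..card Q}"
    using Q(2) card_image_le[OF Q(2), of "\<lambda>p. nat (- (A p c div B p c))"] by (auto simp: Z_def)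
  then have "\<not> {..card Q} \<subseteq> Z" using card_mono leD by blast
  then obtain k where k: "k \<le> card Q" "k \<notin> Z" by auto
  let ?c = "c(h := k)"
  have eq: "A p ?c = A p c" "B p ?c = B p c" if "p \<in> P" for p
    using insert.hyps multiaffine_cong[OF AB(2)[OF that], of ?c c] multiaffine_cong[OF AB(3)[OF that], of ?c c]
    by auto
  have "F p ?c \<noteq> 0" if p: "p \<in> P" for p
  proof (cases "p \<in> Q")
    case True
    show ?thesis
    proof
      assume "F p ?c = 0"
      then have "A p c = B p c * (- int k)" using AB(1)[OF p, of ?c] eq[OF p] by (simp add: algebra_simps)
      then have "A p c div B p c = - int k"
        using B0[OF True] by (metis nonzero_mult_div_cancel_left)
      then show False using k(2) True by (force simp: Z_def)
    qed
  next
    case False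
    then have "B p c = 0" using p by (auto simp: Q_def)
    then show ?thesis using AB(1)[OF p, of ?c] eq[OF p] A0[OF p False] by auto
  qed
  moreover have "sum ?c (insert h L) \<le> sum d P"
  proof -
    \<comment> \<open>Each function in \<open>Q\<close> gave up one degree, which pays for the value
      \<open>k \<le> card Q\<close> of the new variable.\<close>
    have "sum d' P + card Q = (\<Sum>p\<in>P. d' p + (if p \<in> Q then 1 else 0))"
      using \<open>finite P\<close> Q by (simp add: sum.distrib sum.If_cases Int_absorb1)
    also have "\<dots> = sum d P"
    proof (rule sum.cong)
      fix p assume "p \<in> P"
      then show "d' p + (if p \<in> Q then 1 else 0) = d p"
        using AB(4)[of p] by (cases "d p") (auto simp: d'_def Q_def)
    qed simp
    moreover have "sum ?c L = sum c L" using insert.hyps by (intro sum.cong) auto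
    ultimately show ?thesis using c(3) k(1) insert.hyps by simp
  qed
  moreover have "\<forall>h'. h' \<notin> insert h L \<longrightarrow> ?c h' = 0" using c(1) by simp
  ultimately show ?case by blast
qed

section \<open>Words and pattern counts\<close>

lemma words_over_simps [simp]:
  "[] \<in> words_over A"
  "l # w \<in> words_over A \<longleftrightarrow> fst l \<in> A \<and> w \<in> words_over A"
  "u @ w \<in> words_over A \<longleftrightarrow> u \<in> words_over A \<and> w \<in> words_over A"
  by (auto simp: words_over_def)

lemma inv_word_simps [simp]:
  "inv_word [] = []"
  "inv_word (l # w) = inv_word w @ [(fst l, \<not> snd l)]"
  "inv_word (u @ w) = inv_word w @ inv_word u"
  "inv_word (inv_word w) = w"
  "inv_word w \<in> words_over A \<longleftrightarrow> w \<in> words_over A"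
  by (auto simp: inv_word_def words_over_def rev_map o_def case_prod_unfold)

lemma words_over_filter [simp]: "filter (\<lambda>l. fst l \<in> A) w \<in> words_over A"
  by (auto simp: words_over_def)

lemma filter_words_over: "w \<in> words_over A \<Longrightarrow> filter (\<lambda>l. fst l \<in> A) w = w"
  by (auto simp: words_over_def filter_id_conv)

lemma filter_inv_word:
  "filter (\<lambda>l. fst l \<in> A) (inv_word w) = inv_word (filter (\<lambda>l. fst l \<in> A) w)"
  by (induction w) auto

lemma words_over_mono: "A \<subseteq> B \<Longrightarrow> w \<in> words_over A \<Longrightarrow> w \<in> words_over B"
  by (auto simp: words_over_def)

text \<open>Signed number of occurrences of a pattern of generators as a (scattered) subword:
the corner entry of the unipotent matrix obtained by sending each generator \<open>t\<close> to the identity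
plus the sum of the elementary matrices \<open>E\<^sub>j\<^sub>,\<^sub>j\<^sub>+\<^sub>1\<close> over the positions \<open>j\<close> of \<open>t\<close> in the pattern.\<close>

fun pattern_count :: "'a list \<Rightarrow> 'a word \<Rightarrow> int" where
  "pattern_count [] w = 1"
| "pattern_count (t # ts) [] = 0"
| "pattern_count (t # ts) (l # w) = pattern_count (t # ts) w +
     (if fst l = t then (if snd l then 1 else -1) * pattern_count ts w else 0)"

lemma pattern_count_missing:
  "t \<in> set ts \<Longrightarrow> t \<notin> fst ` set w \<Longrightarrow> pattern_count ts w = 0"
  by (induction ts w rule: pattern_count.induct) auto

lemma pattern_count_skip:
  "(\<forall>l\<in>set u. fst l \<noteq> t) \<Longrightarrow> pattern_count (t # ts) (u @ w) = pattern_count (t # ts) w"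
  by (induction u) auto

lemma pattern_count_short: "length w < length ts \<Longrightarrow> pattern_count ts w = 0"
  by (induction ts w rule: pattern_count.induct) auto

text \<open>The only occurrence of the full pattern is the word itself, so the count is a product of
  signs.\<close>

lemma pattern_count_self: "pattern_count (map fst w) w \<noteq> 0"
  by (induction w) (auto simp: pattern_count_short)

text \<open>As \<open>t\<close> does not recur in the pattern, an occurrence uses at most one letter
  of the block. Hence the count is linear in the exponent \<open>n\<close>.\<close>

lemma pattern_count_replicate:
  assumes "t \<notin> set ts"
  shows "pattern_count ts (replicate n (t, b) @ w) = pattern_count ts w"
    and "pattern_count (t # ts) (replicate n (t, b) @ w) =
      pattern_count (t # ts) w + int n * (if b then 1 else -1) * pattern_count ts w"
proof -
  show *: "pattern_count ts (replicate n (t, b) @ w) = pattern_count ts w" for n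
    using assms by (cases ts) (auto intro!: pattern_count_skip)
  show "pattern_count (t # ts) (replicate n (t, b) @ w) =
      pattern_count (t # ts) w + int n * (if b then 1 else -1) * pattern_count ts w"
    by (induction n) (auto simp: * algebra_simps)
qed

text \<open>A one-letter pattern counts the exponent sum of \<open>y\<close>, a homomorphism to the
  integers.\<close>

lemma exponent_sum_simps [simp]:
  "pattern_count [y] (u @ w) = pattern_count [y] u + pattern_count [y] w"
  "pattern_count [y] (inv_word w) = - pattern_count [y] w"
proof -
  show *: "pattern_count [y] (u @ w) = pattern_count [y] u + pattern_count [y] w" for u w
    by (induction u) auto
  show "pattern_count [y] (inv_word w) = - pattern_count [y] w"
    by (induction w) (auto simp: *)
qed

lemma abs_exponent_sum_le: "\<bar>pattern_count [y] w\<bar> \<le> int (length w)"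
  by (induction w) auto

section \<open>The group as words modulo relator moves, and its invariants\<close>

locale commutation_graph =
  fixes E :: "'a \<Rightarrow> 'a \<Rightarrow> bool"
  assumes sym: "E x y \<Longrightarrow> E y x" and irrefl: "\<not> E x x"
begin

abbreviation req :: "'a word \<Rightarrow> 'a word \<Rightarrow> bool" (infix "\<approx>" 50) where
  "u \<approx> w \<equiv> raag_eq E u w"

definition star :: "'a \<Rightarrow> 'a set" where "star x = {y. y = x \<or> E x y}"

definition link :: "'a \<Rightarrow> 'a set" where "link x = {y. E x y}"

lemma req_refl [simp]: "u \<approx> u"
  by (simp add: raag_eq_def)

lemma req_sym: "u \<approx> w \<Longrightarrow> w \<approx> u"
  unfolding raag_eq_def by (rule equivclp_sym)

lemma req_trans [trans]: "u \<approx> v \<Longrightarrow> v \<approx> w \<Longrightarrow> u \<approx> w"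
  unfolding raag_eq_def by (rule equivclp_trans)

lemma equivp_req: "equivp (raag_eq E)"
  by (intro equivpI reflpI sympI transpI) (auto intro: req_sym req_trans)

lemma step_req: "raag_step E u w \<Longrightarrow> u \<approx> w"
  by (auto simp: raag_eq_def)

lemma req_lift:
  assumes "u \<approx> w" "equivp R" "\<And>u w. raag_step E u w \<Longrightarrow> R (f u) (f w)"
  shows "R (f u) (f w)"
  using assms(1) unfolding raag_eq_def
proof (induction rule: equivclp_induct)
  case base
  show ?case using assms(2) by (simp add: equivp_reflp)
next
  case (step v w)
  then show ?case using assms(2,3) by (meson equivp_symp equivp_transp)
qed

lemma step_context: "raag_step E u w \<Longrightarrow> raag_step E (a @ u @ b) (a @ w @ b)"
proof (induction rule: raag_step.induct)
  case (cancel u x c w)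
  show ?case using raag_step.cancel[of E "a @ u" x c "w @ b"] by simp
next
  case (commute x y u c d w)
  then show ?case using raag_step.commute[of E x y "a @ u" c d "w @ b"] by simp
qed

lemma req_context: "u \<approx> w \<Longrightarrow> a @ u @ b \<approx> a @ w @ b"
  by (rule req_lift[OF _ equivp_req]) (auto intro: step_req step_context)

lemma req_append: "u \<approx> u' \<Longrightarrow> w \<approx> w' \<Longrightarrow> u @ w \<approx> u' @ w'"
  using req_context[of u u' "[]" w] req_context[of w w' u' "[]"] by (auto intro: req_trans)

lemma req_inv_right: "w @ inv_word w \<approx> []"
proof (induction w)
  case (Cons l w)
  have "[l] @ (w @ inv_word w) @ inv_word [l] \<approx> [l] @ [] @ inv_word [l]"
    by (rule req_context[OF Cons])
  also have "\<dots> \<approx> []"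
    using step_req[OF raag_step.cancel[of E "[]" "fst l" "snd l" "[]"]] by simp
  finally show ?case by simp
qed auto

lemma req_inv_left: "inv_word w @ w \<approx> []"
  using req_inv_right[of "inv_word w"] by simp

lemma req_cancel_right: "u @ w @ inv_word w \<approx> u" "u @ inv_word w @ w \<approx> u"
  using req_append[OF req_refl req_inv_right] req_append[OF req_refl req_inv_left] by fastforce+

lemma req_cancel_left: "w @ inv_word w @ u \<approx> u" "inv_word w @ w @ u \<approx> u"
  using req_append[OF req_inv_right req_refl] req_append[OF req_inv_left req_refl] by fastforce+

lemma req_left_iff: "a @ u \<approx> a @ w \<longleftrightarrow> u \<approx> w"
proof
  assume "a @ u \<approx> a @ w"
  then have "inv_word a @ a @ u \<approx> inv_word a @ a @ w" by (rule req_append[OF req_refl])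
  then show "u \<approx> w" using req_cancel_left(2) req_sym req_trans by meson
qed (simp add: req_append)

lemma req_right_iff: "u @ a \<approx> w @ a \<longleftrightarrow> u \<approx> w"
proof
  assume "u @ a \<approx> w @ a"
  then have "(u @ a) @ inv_word a \<approx> (w @ a) @ inv_word a" by (rule req_append[OF _ req_refl])
  then show "u \<approx> w" using req_cancel_right(1) req_sym req_trans append_assoc by metis
qed (simp add: req_append)

lemma req_move_left: "a @ u \<approx> w \<longleftrightarrow> u \<approx> inv_word a @ w"
  using req_left_iff[of a u "inv_word a @ w"] req_cancel_left(1)[of a w] req_sym req_trans by meson

lemma req_move_right: "u @ a \<approx> w \<longleftrightarrow> u \<approx> w @ inv_word a"
  using req_right_iff[of u a "w @ inv_word a"] req_cancel_right(2)[of w a] req_sym req_trans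
  by (metis append_assoc)

lemma req_inv: "u \<approx> w \<Longrightarrow> inv_word u \<approx> inv_word w"
  using req_move_left[of u "inv_word w" "[]"] req_append[of u w "inv_word w" "inv_word w"]
    req_inv_right[of w] by (auto intro: req_sym req_trans)

lemma req_commute_letters: "E (fst l) (fst m) \<Longrightarrow> [l, m] \<approx> [m, l]"
  using step_req[OF raag_step.commute[of E "fst l" "fst m" "[]" "snd l" "snd m" "[]"]] by simp

lemma req_commute_star_letter:
  assumes "fst l \<in> star (fst m)"
  shows "[l, m] \<approx> [m, l]"
proof (cases "fst l = fst m")
  case True
  show ?thesis
  proof (cases "snd l = snd m")
    case False
    then have "m = (fst l, \<not> snd l)" using True by (cases m) auto
    then show ?thesis
      using req_inv_right[of "[l]"] req_inv_left[of "[l]"] by (auto intro: req_sym req_trans)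
  qed (use True prod_eq_iff[of l m] in auto)
next
  case False
  then show ?thesis using assms sym by (auto simp: star_def intro!: req_commute_letters)
qed

lemma req_commute_star: "w \<in> words_over (star (fst m)) \<Longrightarrow> w @ [m] \<approx> m # w"
proof (induction w)
  case (Cons l w)
  have "[l] @ w @ [m] \<approx> [l] @ m # w" using Cons by (intro req_append) auto
  also have "[l] @ m # w \<approx> [m, l] @ w"
    using req_append[OF req_commute_star_letter[of l m] req_refl[of w]] Cons.prems by simp
  finally show ?case by simp
qed auto

text \<open>Deleting the letters outside \<open>A\<close> is the retraction onto the subgroup
  generated by \<open>A\<close>: each relator becomes a relator or disappears.\<close>

lemma req_filter: "u \<approx> w \<Longrightarrow> filter (\<lambda>l. fst l \<in> A) u \<approx> filter (\<lambda>l. fst l \<in> A) w"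
proof (erule req_lift[OF _ equivp_req])
  fix u w :: "'a word"
  assume "raag_step E u w"
  then show "filter (\<lambda>l. fst l \<in> A) u \<approx> filter (\<lambda>l. fst l \<in> A) w"
    by (induction rule: raag_step.induct)
      (auto intro!: step_req intro: raag_step.intros[simplified])
qed

text \<open>Consecutive types neither coincide nor commute, so this is a walk in the complement
  graph; types may recur.\<close>

definition walk :: "'a list \<Rightarrow> bool" where
  "walk ts \<longleftrightarrow> successively (\<lambda>s t. t \<notin> star s) ts"

lemma walk_Cons: "walk (t # ts) \<Longrightarrow> walk ts \<and> (ts = [] \<or> hd ts \<notin> star t)"
  by (cases ts) (auto simp: walk_def)

text \<open>No occurrence of a walk uses both letters of a relator pair, since these would be
  consecutive in the pattern. Occurrences using one letter of a cancelling pair cancel by sign;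
  those using one letter of a commuting pair survive the swap.\<close>

lemma pattern_count_cong: "u \<approx> w \<Longrightarrow> walk ts \<Longrightarrow> pattern_count ts u = pattern_count ts w"
proof -
  assume "u \<approx> w" "walk ts"
  \<comment> \<open>All walks are treated at once because reading off a common prefix shortens the
    pattern.\<close>
  have "\<forall>ts. walk ts \<longrightarrow> pattern_count ts u = pattern_count ts w"
  proof (rule req_lift[OF \<open>u \<approx> w\<close>,
        where f = id and R = "\<lambda>u w. \<forall>ts. walk ts \<longrightarrow> pattern_count ts u = pattern_count ts w",
        unfolded id_apply])
    show "equivp (\<lambda>u w. \<forall>ts. walk ts \<longrightarrow> pattern_count ts u = pattern_count ts w)"
      by (intro equivpI reflpI sympI transpI) auto
    fix u w :: "'a word"
    have context_free: "\<forall>ts. walk ts \<longrightarrow> pattern_count ts (a @ u) = pattern_count ts (a @ w)"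
      if "\<And>ts. walk ts \<Longrightarrow> pattern_count ts u = pattern_count ts w" for a u w
    proof (induction a)
      case (Cons l a)
      show ?case
      proof (intro allI impI)
        fix ts assume "walk ts"
        then show "pattern_count ts ((l # a) @ u) = pattern_count ts ((l # a) @ w)"
          using Cons walk_Cons by (cases ts) auto
      qed
    qed (use that in auto)
    assume "raag_step E u w"
    then show "\<forall>ts. walk ts \<longrightarrow> pattern_count ts u = pattern_count ts w"
    proof cases
      case (cancel a x b v)
      have "pattern_count ts ([(x, b), (x, \<not> b)] @ v) = pattern_count ts v" if "walk ts" for ts
        using that by (cases ts; cases "tl ts") (auto simp: walk_def star_def)
      then show ?thesis using context_free cancel by blast
    next
      case (commute x y a b c v)
      have "pattern_count ts ([(x, b), (y, c)] @ v) = pattern_count ts ([(y, c), (x, b)] @ v)"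
        if "walk ts" for ts
        using that commute(3) irrefl sym by (cases ts; cases "tl ts") (auto simp: walk_def star_def)
      then show ?thesis using context_free commute by blast
    qed
  qed
  then show ?thesis using \<open>walk ts\<close> by blast
qed

text \<open>The first type of the pattern is missing from \<open>u\<close>, so an occurrence would
  lie in \<open>w\<close>, where the last type is missing.\<close>

lemma pattern_count_star_product:
  assumes "ts \<noteq> []" "hd ts \<notin> star x" "last ts \<notin> star y"
    and "u \<in> words_over (star x)" "w \<in> words_over (star y)"
  shows "pattern_count ts (u @ w) = 0"
proof -
  obtain t ts' where ts: "ts = t # ts'" using assms(1) by (cases ts) auto
  have "pattern_count ts (u @ w) = pattern_count ts w"
    unfolding ts by (rule pattern_count_skip) (use assms ts in \<open>auto simp: words_over_def\<close>)
  also have "\<dots> = 0"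
    by (rule pattern_count_missing[of "last ts"]) (use assms in \<open>auto simp: words_over_def\<close>)
  finally show ?thesis .
qed

section \<open>Geodesic words\<close>

definition geodesic :: "'a word \<Rightarrow> bool" where
  "geodesic w \<longleftrightarrow> (\<forall>u. u \<approx> w \<longrightarrow> length w \<le> length u)"

lemma geodesic_factor: "geodesic (a @ w @ b) \<Longrightarrow> geodesic w"
  unfolding geodesic_def using req_context[of _ w a b] by fastforce

text \<open>The retraction to \<open>A\<close> fixes the group element and only deletes letters, so
  a geodesic has none to delete.\<close>

lemma geodesic_words_over:
  assumes "geodesic w" "w \<approx> u" "u \<in> words_over A"
  shows "w \<in> words_over A"
proof -
  let ?f = "filter (\<lambda>l. fst l \<in> A)"
  have "?f w \<approx> w"
    using req_filter[OF assms(2), of A] filter_words_over[OF assms(3)] assms(2)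
    by (auto intro: req_sym req_trans)
  then have "length w \<le> length (?f w)" using assms(1) by (auto simp: geodesic_def)
  then have "?f w = w" by (metis filter_id_conv length_filter_less not_less)
  then show ?thesis by (metis words_over_filter)
qed

lemma geodesic_exists: "\<exists>u. geodesic u \<and> u \<approx> w"
proof -
  obtain u where "u \<approx> w" "\<And>v. v \<approx> w \<Longrightarrow> length u \<le> length v"
    using ex_has_least_nat[of "\<lambda>u. u \<approx> w" w length] by auto
  then show ?thesis unfolding geodesic_def by (meson req_trans)
qed

section \<open>Hyperplanes and thickening\<close>

text \<open>A left coset of the link subgroup, given as the set of all words representing its
  elements.\<close>

definition link_coset :: "'a \<Rightarrow> 'a word \<Rightarrow> 'a word set" where
  "link_coset x p = {q. \<exists>s\<in>words_over (link x). q \<approx> p @ s}"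

lemma link_coset_self: "p \<in> link_coset x p"
  unfolding link_coset_def by (auto intro!: bexI[of _ "[]"])

lemma link_coset_eq_iff:
  "link_coset x p = link_coset x q \<longleftrightarrow> (\<exists>s\<in>words_over (link x). q \<approx> p @ s)"
proof
  show "link_coset x p = link_coset x q \<Longrightarrow> \<exists>s\<in>words_over (link x). q \<approx> p @ s"
    using link_coset_self[of q x] by (auto simp: link_coset_def)
next
  have sub: "link_coset x q \<subseteq> link_coset x p" if "s \<in> words_over (link x)" "q \<approx> p @ s" for p q s
  proof
    fix r assume "r \<in> link_coset x q"
    then obtain t where t: "t \<in> words_over (link x)" "r \<approx> q @ t" by (auto simp: link_coset_def)
    then have "r \<approx> p @ s @ t" using req_append[OF that(2) req_refl[of t]] by (auto intro: req_trans)
    then show "r \<in> link_coset x p" using t that by (auto simp: link_coset_def intro!: bexI[of _ "s @ t"])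
  qed
  assume "\<exists>s\<in>words_over (link x). q \<approx> p @ s"
  then obtain s where s: "s \<in> words_over (link x)" "q \<approx> p @ s" by auto
  then have "p \<approx> q @ inv_word s" using req_move_right req_sym by blast
  then show "link_coset x p = link_coset x q" using sub s by (metis inv_word_simps(5) subset_antisym)
qed

text \<open>The hyperplane of the universal cover of the Salvetti complex crossed by the edge that leaves
the vertex \<open>p\<close> along the letter \<open>l\<close>; the coset is that of the tail of the positively oriented edge.\<close>

definition hyp :: "'a word \<Rightarrow> 'a \<times> bool \<Rightarrow> 'a \<times> 'a word set" where
  "hyp p l = (fst l, link_coset (fst l) (if snd l then p else p @ [l]))"

lemma fst_hyp [simp]: "fst (hyp p l) = fst l"
  by (simp add: hyp_def)

lemma hyp_cong: "p \<approx> q \<Longrightarrow> hyp p l = hyp q l"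
  unfolding hyp_def
  by (auto simp: link_coset_eq_iff intro!: bexI[of _ "[]"] intro: req_sym req_append)

lemma hyp_inverse: "hyp (p @ [(x, b)]) (x, \<not> b) = hyp p (x, b)"
  using req_cancel_right(1)[of p "[(x, True)]"] req_cancel_right(2)[of p "[(x, True)]"]
  by (auto simp: hyp_def link_coset_eq_iff intro!: bexI[of _ "[]"] intro: req_sym)

text \<open>Opposite edges of a square cross the same hyperplane.\<close>

lemma hyp_commute:
  assumes "E (fst l) (fst m)"
  shows "hyp (p @ [m]) l = hyp p l"
proof -
  have "(p @ [l]) @ [m] \<approx> p @ [m, l]"
    using req_append[OF req_refl req_commute_letters[OF assms]] by simp
  then show ?thesis
    using assms unfolding hyp_def prod.inject eq_commute[of "link_coset _ (if _ then p @ _ else _)"]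
    by (auto simp: link_coset_eq_iff link_def intro!: bexI[of _ "[m]"] intro: req_sym)
qed

fun hyps :: "'a word \<Rightarrow> 'a word \<Rightarrow> ('a \<times> 'a word set) list" where
  "hyps p [] = []"
| "hyps p (l # w) = hyp p l # hyps (p @ [l]) w"

fun thicken :: "('a \<times> 'a word set \<Rightarrow> nat) \<Rightarrow> 'a word \<Rightarrow> 'a word \<Rightarrow> 'a word" where
  "thicken c p [] = []"
| "thicken c p (l # w) = replicate (c (hyp p l)) l @ thicken c (p @ [l]) w"

lemma thicken_append: "thicken c p (u @ w) = thicken c p u @ thicken c (p @ u) w"
  by (induction u arbitrary: p) auto

lemma thicken_base_cong: "p \<approx> q \<Longrightarrow> thicken c p w = thicken c q w"
proof (induction w arbitrary: p q)
  case (Cons l w)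
  then show ?case using hyp_cong[of p q l] Cons.IH[of "p @ [l]" "q @ [l]"] by (simp add: req_append)
qed auto

lemma set_thicken: "set (thicken c p w) \<subseteq> set w"
  by (induction w arbitrary: p) auto

lemma thicken_words_over: "w \<in> words_over A \<Longrightarrow> thicken c p w \<in> words_over A"
  using set_thicken by (fastforce simp: words_over_def)

lemma inv_word_replicate: "inv_word (replicate n (x, b)) = replicate n (x, \<not> b)"
  by (induction n) (auto simp: replicate_append_same)

lemma replicate_commute:
  assumes "E (fst l) (fst m)"
  shows "replicate i l @ replicate j m \<approx> replicate j m @ replicate i l"
proof (induction j)
  case (Suc j)
  have "replicate i l @ [m] \<approx> m # replicate i l"
    by (rule req_commute_star) (use assms sym in \<open>auto simp: words_over_def star_def\<close>)
  then have "(replicate i l @ [m]) @ replicate j m \<approx> (m # replicate i l) @ replicate j m"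
    by (rule req_append) auto
  also have "\<dots> \<approx> [m] @ replicate j m @ replicate i l"
    using req_append[OF req_refl Suc, of "[m]"] by simp
  finally show ?case by simp
qed auto

text \<open>Every relator crosses the same hyperplanes in opposite directions, so thickening is
well defined on group elements (although it is not a homomorphism).\<close>

lemma thicken_cong: "u \<approx> w \<Longrightarrow> thicken c p u \<approx> thicken c p w"
proof (erule req_lift[OF _ equivp_req])
  fix u w :: "'a word"
  assume "raag_step E u w"
  then show "thicken c p u \<approx> thicken c p w"
  proof cases
    case (cancel a x b v)
    have "thicken c (p @ a) [(x, b), (x, \<not> b)] \<approx> []"
      using req_inv_right[of "replicate (c (hyp (p @ a) (x, b))) (x, b)"]
        hyp_inverse[of "p @ a" x b] by (simp add: inv_word_replicate)
    moreover have "thicken c (p @ a @ [(x, b), (x, \<not> b)]) v = thicken c (p @ a) v"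
      using req_cancel_right(1)[of "p @ a" "[(x, b)]"] by (intro thicken_base_cong) simp
    ultimately show ?thesis
      unfolding cancel thicken_append
      using req_context[of "thicken c (p @ a) [(x, b), (x, \<not> b)]" "[]" "thicken c p a" "thicken c (p @ a) v"]
      by simp
  next
    case (commute x y a b d v)
    have "thicken c (p @ a) [(x, b), (y, d)] \<approx> thicken c (p @ a) [(y, d), (x, b)]"
      using replicate_commute[of "(x, b)" "(y, d)"] hyp_commute[of "(x, b)" "(y, d)" "p @ a"]
        hyp_commute[of "(y, d)" "(x, b)" "p @ a"] commute(3) sym by simp
    moreover have "thicken c (p @ a @ [(x, b), (y, d)]) v = thicken c (p @ a @ [(y, d), (x, b)]) v"
      using commute(3) by (intro thicken_base_cong req_append req_commute_letters) auto
    ultimately show ?thesis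
      unfolding commute thicken_append
      using req_context[of "thicken c (p @ a) [(x, b), (y, d)]" "thicken c (p @ a) [(y, d), (x, b)]"
          "thicken c p a" "thicken c (p @ a @ [(x, b), (y, d)]) v"] by simp
  qed
qed

lemma length_thicken: "length (thicken c p w) = sum_list (map c (hyps p w))"
  by (induction w arbitrary: p) auto

lemma thicken_weight_cong:
  "\<forall>h\<in>set (hyps p w). c h = c' h \<Longrightarrow> thicken c p w = thicken c' p w"
  by (induction w arbitrary: p) auto

lemma thicken_unit: "\<forall>h\<in>set (hyps p w). c h = 1 \<Longrightarrow> thicken c p w = w"
  by (induction w arbitrary: p) auto

lemma hyps_append: "hyps p (u @ w) = hyps p u @ hyps (p @ u) w"
  by (induction u arbitrary: p) auto

lemma in_set_hyps: "h \<in> set (hyps p w) \<Longrightarrow> \<exists>u l v. w = u @ l # v \<and> h = hyp (p @ u) l"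
proof (induction w arbitrary: p)
  case (Cons m w)
  show ?case
  proof (cases "h = hyp p m")
    case True
    then show ?thesis by (intro exI[of _ "[]"] exI[of _ m] exI[of _ w]) simp
  next
    case False
    then obtain u l v where "w = u @ l # v" "h = hyp ((p @ [m]) @ u) l"
      using Cons.IH[of "p @ [m]"] Cons.prems by auto
    then show ?thesis by (intro exI[of _ "m # u"] exI[of _ l] exI[of _ v]) simp
  qed
qed simp

section \<open>Commuting conjugates of generators\<close>

text \<open>Conjugating by a high power of \<open>y\<close> moves the letters outside the star of \<open>y\<close> to \<open>y\<close>-heights
that do not occur in \<open>z\<close>; collapsing the hyperplanes of small height keeps the conjugate intact
but pushes \<open>z\<close> into the subgroup generated by the star.\<close>

lemma centralizer_generator:
  assumes "z @ [(y, True)] \<approx> (y, True) # z"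
  shows "\<exists>s\<in>words_over (star y). z \<approx> s"
proof -
  define n where "n = length z"
  \<comment> \<open>Along \<open>z\<close> the exponent sum of \<open>y\<close> stays in
    \<open>[-n, n]\<close>; after the shift by \<open>2 * n + 1\<close> it is at least
    \<open>n + 1\<close>.\<close>
  define Y where "Y = replicate (2 * n + 1) (y, True)"
  \<comment> \<open>The choice of representative is immaterial for a type outside the star of
    \<open>y\<close>: its link omits \<open>y\<close>, so the exponent sum of \<open>y\<close> is
    constant on the coset.\<close>
  define ht where "ht C = pattern_count [y] (SOME q. q \<in> C)" for C :: "'a word set"
  define c :: "'a \<times> 'a word set \<Rightarrow> nat" where
    "c = (\<lambda>(x, C). if x \<notin> star y \<and> \<bar>ht C\<bar> \<le> int n then 0 else 1)"
  have ht: "ht (link_coset x q) = pattern_count [y] q" if "x \<notin> star y" for x q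
  proof -
    have "(SOME r. r \<in> link_coset x q) \<in> link_coset x q" using link_coset_self by (rule someI)
    then obtain s where s: "s \<in> words_over (link x)" "(SOME r. r \<in> link_coset x q) \<approx> q @ s"
      by (auto simp: link_coset_def)
    have "y \<notin> link x" using that sym by (auto simp: link_def star_def)
    then have "pattern_count [y] s = 0"
      using s(1) by (intro pattern_count_missing[of y]) (auto simp: words_over_def)
    then show ?thesis using pattern_count_cong[OF s(2), of "[y]"] by (simp add: ht_def walk_def)
  qed
  \<comment> \<open>An edge whose type lies outside the star of \<open>y\<close> has both ends at
    the same height, so the height of \<open>p\<close> serves for either sign of
    \<open>l\<close>.\<close>
  have c: "c (hyp p l) = (if fst l \<notin> star y \<and> \<bar>pattern_count [y] p\<bar> \<le> int n then 0 else 1)" for p l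
    using ht[of "fst l"] by (auto simp: c_def hyp_def star_def)
  have "replicate i (y, True) @ z \<approx> z @ replicate i (y, True)" for i
  proof (induction i)
    case (Suc i)
    have "[(y, True)] @ replicate i (y, True) @ z \<approx> [(y, True)] @ z @ replicate i (y, True)"
      by (rule req_append[OF req_refl Suc])
    also have "\<dots> \<approx> (z @ [(y, True)]) @ replicate i (y, True)"
      using req_append[OF req_sym[OF assms] req_refl] by simp
    finally show ?case by simp
  qed auto
  then have "(Y @ z) \<approx> z @ Y" unfolding Y_def .
  then have conj: "Y @ z @ inv_word Y \<approx> z"
    using req_move_right[of z Y "Y @ z"] by (auto intro: req_sym)
  have "thicken c [] (Y @ z @ inv_word Y) = Y @ z @ inv_word Y"
  proof (rule thicken_unit, intro ballI)
    fix h assume "h \<in> set (hyps [] (Y @ z @ inv_word Y))"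
    then consider "h \<in> set (hyps [] Y)" | "h \<in> set (hyps Y z)" | "h \<in> set (hyps (Y @ z) (inv_word Y))"
      by (auto simp: hyps_append)
    then show "c h = 1"
    proof cases
      case 1
      then obtain u l v where u: "Y = u @ l # v" "h = hyp u l" by (auto dest: in_set_hyps)
      then have "l \<in> set Y" by simp
      then have "fst l = y" by (auto simp: Y_def)
      then show ?thesis using c[of u l] u(2) by (simp add: star_def)
    next
      case 2
      then obtain u l v where u: "z = u @ l # v" "h = hyp (Y @ u) l" by (auto dest: in_set_hyps)
      have "pattern_count [y] (replicate m (y, True)) = int m" for m
        by (induction m) auto
      then have "pattern_count [y] (Y @ u) = 2 * int n + 1 + pattern_count [y] u" by (simp add: Y_def)
      moreover have "\<bar>pattern_count [y] u\<bar> \<le> int n"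
        using abs_exponent_sum_le[of y u] u(1) by (simp add: n_def)
      ultimately show ?thesis using c[of "Y @ u" l] u(2) by auto
    next
      case 3
      then obtain u l v where u: "inv_word Y = u @ l # v" "h = hyp ((Y @ z) @ u) l"
        by (auto dest: in_set_hyps)
      then have "l \<in> set (inv_word Y)" by simp
      then have "fst l = y" by (auto simp: Y_def inv_word_def)
      then show ?thesis using c[of "(Y @ z) @ u" l] u(2) by (simp add: star_def)
    qed
  qed
  then have "z \<approx> thicken c [] z"
    using conj thicken_cong[OF conj, of c "[]"] by (auto intro: req_sym req_trans)
  \<comment> \<open>Read from the identity, \<open>z\<close> stays at small heights, so all its
    letters outside the star get weight zero.\<close>
  moreover have "thicken c p v \<in> words_over (star y)" if "z = p @ v" for p v
    using that
  proof (induction v arbitrary: p)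
    case (Cons l v)
    have "\<bar>pattern_count [y] p\<bar> \<le> int n"
      using abs_exponent_sum_le[of y p] Cons.prems by (simp add: n_def)
    then show ?case using Cons.IH[of "p @ [l]"] Cons.prems c[of p l] by (auto simp: words_over_def)
  qed auto
  ultimately show ?thesis by fastforce
qed

text \<open>Words over the star commute with \<open>x\<close>, so the conjugate depends only on the
  coset of its conjugator.\<close>

lemma conj_star:
  assumes "s \<in> words_over (star x)" "h \<approx> g @ s"
  shows "h @ [(x, True)] @ inv_word h \<approx> g @ [(x, True)] @ inv_word g"
proof -
  have "h @ [(x, True)] @ inv_word h \<approx> (g @ s) @ [(x, True)] @ inv_word (g @ s)"
    using assms(2) by (intro req_append req_inv) auto
  also have "\<dots> = g @ (s @ [(x, True)]) @ inv_word s @ inv_word g" by simp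
  also have "\<dots> \<approx> g @ ((x, True) # s) @ inv_word s @ inv_word g"
    using req_commute_star[of s "(x, True)"] assms(1) by (intro req_append) auto
  also have "\<dots> = (g @ [(x, True)]) @ (s @ inv_word s) @ inv_word g" by simp
  also have "\<dots> \<approx> (g @ [(x, True)]) @ [] @ inv_word g"
    by (rule req_context[OF req_inv_right])
  finally show ?thesis by simp
qed

lemma commutes_cong:
  assumes "u \<approx> u'" "w \<approx> w'"
  shows "commutes E u w \<longleftrightarrow> commutes E u' w'"
  using req_append[OF assms] req_append[OF assms(2,1)] unfolding commutes_def
  by (meson req_sym req_trans)

lemma commutes_conj:
  "commutes E (g @ u @ inv_word g) (g @ w @ inv_word g) \<longleftrightarrow> commutes E u w"
proof -
  have *: "(g @ u @ inv_word g) @ (g @ w @ inv_word g) \<approx> g @ (u @ w) @ inv_word g" for u w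
    using req_context[OF req_inv_left, of "g @ u" g "w @ inv_word g"] by simp
  have "commutes E (g @ u @ inv_word g) (g @ w @ inv_word g) \<longleftrightarrow>
      g @ (u @ w) @ inv_word g \<approx> g @ (w @ u) @ inv_word g"
    unfolding commutes_def using *[of u w] *[of w u] by (meson req_sym req_trans)
  then show ?thesis by (simp only: commutes_def req_left_iff req_right_iff)
qed

text \<open>After conjugation by \<open>h\<close>, the element
  \<open>inv_word w @ [(x, True)] @ w\<close> centralizes \<open>y\<close>, so the retraction to the
  star of \<open>y\<close> fixes it. Comparing it with its image shows that \<open>w\<close> times
  the inverse of its retract centralizes \<open>x\<close>, which yields a common point of the two
  cosets.\<close>

lemma commuting_conjugates:
  assumes "commutes E (g @ [(x, True)] @ inv_word g) (h @ [(y, True)] @ inv_word h)"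
  shows "x \<in> star y" "\<exists>s\<in>words_over (star x). \<exists>s'\<in>words_over (star y). h @ s' \<approx> g @ s"
proof -
  define w where "w = inv_word g @ h"
  let ?r = "filter (\<lambda>l. fst l \<in> star y)"
  have "g @ [(x, True)] @ inv_word g \<approx> h @ (inv_word w @ [(x, True)] @ w) @ inv_word h"
  proof -
    have "h @ inv_word w \<approx> g" using req_cancel_left(1)[of h g] by (simp add: w_def)
    from req_append[OF this req_append[OF req_refl req_inv[OF this]], of "[(x, True)]"]
    show ?thesis by (auto intro: req_sym)
  qed
  then have "commutes E (h @ (inv_word w @ [(x, True)] @ w) @ inv_word h) (h @ [(y, True)] @ inv_word h)"
    using assms commutes_cong req_refl by blast
  then have "commutes E (inv_word w @ [(x, True)] @ w) [(y, True)]"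
    unfolding commutes_conj .
  then obtain u where u: "u \<in> words_over (star y)" "inv_word w @ [(x, True)] @ w \<approx> u"
    using centralizer_generator[of "inv_word w @ [(x, True)] @ w" y] by (auto simp: commutes_def)
  \<comment> \<open>The exponent sum of \<open>x\<close> is invariant under conjugation, so
    \<open>x\<close> must occur in the word \<open>u\<close> over the star of
    \<open>y\<close>.\<close>
  have "pattern_count [x] u = 1"
    using pattern_count_cong[OF u(2), of "[x]"] by (simp add: walk_def)
  then have "x \<in> fst ` set u" using pattern_count_missing[of x "[x]" u] by force
  then show x: "x \<in> star y" using u(1) by (auto simp: words_over_def)
  have "inv_word (?r w) @ [(x, True)] @ ?r w \<approx> inv_word w @ [(x, True)] @ w"
    using req_filter[OF u(2), of "star y"] filter_words_over[OF u(1)] u(2) x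
    by (auto simp: filter_inv_word intro: req_trans req_sym)
  then have "[(x, True)] @ w \<approx> w @ inv_word (?r w) @ [(x, True)] @ ?r w"
    using req_move_left[of "inv_word w" "[(x, True)] @ w"] by (auto intro: req_sym)
  then have "(w @ inv_word (?r w)) @ [(x, True)] \<approx> (x, True) # w @ inv_word (?r w)"
    using req_move_right[of "w @ inv_word (?r w) @ [(x, True)]" "?r w" "[(x, True)] @ w"]
    by (auto intro: req_sym)
  then obtain s where s: "s \<in> words_over (star x)" "w @ inv_word (?r w) \<approx> s"
    using centralizer_generator by blast
  then have "h @ inv_word (?r w) \<approx> g @ s"
    unfolding w_def using req_move_left[of "inv_word g" "h @ inv_word (?r w)" s] by (simp add: w_def)
  then show "\<exists>s\<in>words_over (star x). \<exists>s'\<in>words_over (star y). h @ s' \<approx> g @ s"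
    using s(1) words_over_filter inv_word_simps(5) by blast
qed

section \<open>Separating non-adjacent vertices\<close>

text \<open>Between two crossings of one hyperplane the path could be moved into the link of its
  type \<open>x\<close>, so the two crossing letters would cancel against each other.\<close>

lemma geodesic_hyps_distinct: "geodesic w \<Longrightarrow> distinct (hyps p w)"
proof (induction w arbitrary: p)
  case (Cons l w)
  have "hyp p l \<notin> set (hyps (p @ [l]) w)"
  proof
    assume "hyp p l \<in> set (hyps (p @ [l]) w)"
    then obtain u m v where w: "w = u @ m # v" and eq: "hyp p l = hyp (p @ [l] @ u) m"
      using in_set_hyps by fastforce
    have geo: "geodesic (l # u @ [m])"
      using Cons.prems geodesic_factor[of "[]" "l # u @ [m]" v] w by simp
    obtain x b b' where lm: "l = (x, b)" "m = (x, b')"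
      using eq by (metis fst_hyp prod.collapse)
    \<comment> \<open>\<open>t\<close> joins the tails of the two edges, so it includes
      \<open>l\<close> only if positive and \<open>m\<close> only if negative. Being a geodesic over
      the link, it contains neither, which leaves \<open>l\<close> negative and \<open>m\<close>
      positive.\<close>
    define t where "t = (if b then [l] else []) @ u @ (if b' then [] else [m])"
    have *: "link_coset x (if b then p else p @ [l])
        = link_coset x (if b' then p @ [l] @ u else p @ [l] @ u @ [m])"
      using eq by (cases b; cases b'; simp add: hyp_def lm)
    then obtain s where s: "s \<in> words_over (link x)"
      "(if b' then p @ [l] @ u else p @ [l] @ u @ [m]) \<approx> (if b then p else p @ [l]) @ s"
      unfolding link_coset_eq_iff by blast
    have "(if b' then p @ [l] @ u else p @ [l] @ u @ [m]) = (if b then p else p @ [l]) @ t"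
      by (simp add: t_def)
    with s(2) have ts: "t \<approx> s" by (simp add: req_left_iff)
    have "geodesic t"
      using geo geodesic_factor[of "[l]" "u @ [m]" "[]"] geodesic_factor[of "[l]" u "[m]"]
        geodesic_factor[of "[]" "l # u" "[m]"] by (auto simp: t_def)
    from geodesic_words_over[OF this ts s(1)] have bb: "\<not> b" "b'" and "u \<in> words_over (link x)"
      using irrefl by (auto simp: t_def lm link_def split: if_splits)
    moreover have "link x \<subseteq> star (fst m)" by (auto simp: lm link_def star_def)
    ultimately have "u @ [m] \<approx> m # u" by (intro req_commute_star) (rule words_over_mono)
    from req_append[OF req_refl this, of "[l]"] have "[l] @ u @ [m] \<approx> [l] @ [m] @ u" by simp
    also have "\<dots> \<approx> u" using req_cancel_left(1)[of "[l]" u] bb by (simp add: lm)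
    finally have "l # u @ [m] \<approx> u" by simp
    from req_sym[OF this] show False using geo unfolding geodesic_def by fastforce
  qed
  then show ?case using Cons geodesic_factor[of "[l]" w "[]"] by simp
qed simp

text \<open>Each hyperplane is crossed once, so weights zero and one can be chosen separately for
  each letter.\<close>

lemma thicken_subseq:
  "distinct (hyps p w) \<Longrightarrow> subseq v w \<Longrightarrow>
    \<exists>K \<subseteq> set (hyps p w). thicken (\<lambda>h. if h \<in> K then 1 else 0) p w = v"
proof (induction w arbitrary: p v)
  case Nil
  then show ?case by (cases v) auto
next
  case (Cons l w)
  let ?c = "\<lambda>K h. if h \<in> K then 1 else (0::nat)"
  show ?case
  proof (cases "subseq v w")
    case True
    then obtain K where "K \<subseteq> set (hyps (p @ [l]) w)" "thicken (?c K) (p @ [l]) w = v"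
      using Cons.IH[of "p @ [l]" v] Cons.prems by auto
    then show ?thesis using Cons.prems by (intro exI[of _ K]) auto
  next
    case False
    then obtain v' where v': "v = l # v'" "subseq v' w"
      using Cons.prems(2) by (cases v) (auto split: if_splits)
    then obtain K where K: "K \<subseteq> set (hyps (p @ [l]) w)" "thicken (?c K) (p @ [l]) w = v'"
      using Cons.IH[of "p @ [l]" v'] Cons.prems by auto
    have "thicken (?c (insert (hyp p l) K)) (p @ [l]) w = thicken (?c K) (p @ [l]) w"
      using Cons.prems by (intro thicken_weight_cong) auto
    then show ?thesis using K v' by (intro exI[of _ "insert (hyp p l) K"]) auto
  qed
qed

text \<open>An occurrence picks one letter for each type of the pattern. As these types are
  distinct, so are the hyperplanes crossed, and no weight is multiplied by itself.\<close>

lemma multiaffine_pattern_count: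
  "distinct ts \<Longrightarrow> multiaffine {h \<in> set (hyps p w). fst h \<in> set ts} (length ts)
     (\<lambda>c. pattern_count ts (thicken c p w))"
proof (induction w arbitrary: p ts)
  case Nil
  then show ?case by (cases ts) (auto intro: multiaffine.const)
next
  case (Cons l w)
  show ?case
  proof (cases ts)
    case Nil
    then show ?thesis by (auto intro: multiaffine.const)
  next
    case ts: (Cons t ts')
    let ?L = "{h \<in> set (hyps p (l # w)). fst h \<in> set ts}"
    have tail: "multiaffine ?L (length ts) (\<lambda>c. pattern_count ts (thicken c (p @ [l]) w))"
      by (rule multiaffine.mono[OF Cons.IH[OF Cons.prems]]) auto
    show ?thesis
    proof (cases "fst l = t")
      case True
      let ?r = "if snd l then 1 else - 1 :: int"
      have "multiaffine (insert (hyp p l) {h \<in> set (hyps (p @ [l]) w). fst h \<in> set ts'}) (Suc (length ts'))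
          (\<lambda>c. int (c (hyp p l)) * ?r * pattern_count ts' (thicken c (p @ [l]) w))"
        using Cons.prems ts True by (intro multiaffine.var Cons.IH) auto
      then have "multiaffine ?L (length ts)
          (\<lambda>c. int (c (hyp p l)) * ?r * pattern_count ts' (thicken c (p @ [l]) w))"
        by (rule multiaffine.mono) (use ts True in auto)
      from multiaffine.add[OF tail this] show ?thesis
        using pattern_count_replicate(2)[of t ts' _ "snd l"] Cons.prems ts True by (cases l) simp
    next
      case False
      then have "pattern_count ts (thicken c p (l # w)) = pattern_count ts (thicken c (p @ [l]) w)" for c
        by (auto simp: ts intro!: pattern_count_skip)
      then show ?thesis using tail by simp
    qed
  qed
qed

text \<open>The assumption says that no letter with type in the star of \<open>y\<close> can be
  commuted to the end. Passing from each such letter to a later one blocking it moves right until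
  the star is left.\<close>

lemma walk_to_star_exit:
  assumes "\<And>u l v. l0 # w = u @ l # v \<Longrightarrow> fst l \<in> star y \<Longrightarrow> \<exists>m\<in>set v. fst m \<notin> star (fst l)"
  shows "\<exists>v. subseq v w \<and> walk (map fst (l0 # v)) \<and> fst (last (l0 # v)) \<notin> star y"
  using assms
proof (induction "length w" arbitrary: l0 w rule: less_induct)
  case less
  show ?case
  proof (cases "fst l0 \<in> star y")
    case False
    then show ?thesis by (intro exI[of _ "[]"]) (auto simp: walk_def)
  next
    case True
    then obtain m where "m \<in> set w" and m: "fst m \<notin> star (fst l0)" using less.prems[of "[]" l0 w] by auto
    then obtain w1 w2 where w: "w = w1 @ m # w2" by (auto dest: split_list)
    have "\<exists>v. subseq v w2 \<and> walk (map fst (m # v)) \<and> fst (last (m # v)) \<notin> star y"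
    proof (rule less.hyps)
      fix u l v assume "m # w2 = u @ l # v" "fst l \<in> star y"
      then show "\<exists>m\<in>set v. fst m \<notin> star (fst l)" using less.prems[of "l0 # w1 @ u" l v] w by simp
    qed (simp add: w)
    then obtain v where v: "subseq v w2" "walk (map fst (m # v))" "fst (last (m # v)) \<notin> star y" by blast
    then have "subseq (m # v) w" unfolding w by (auto intro: list_emb_append2)
    then show ?thesis using v m by (intro exI[of _ "m # v"]) (auto simp: walk_def)
  qed
qed

text \<open>A loop between two letters of equal type is cut out. Their signs may differ, so only the
  types of the end letters are kept.\<close>

lemma distinct_subwalk:
  assumes "walk (map fst v)" "v \<noteq> []"
  shows "\<exists>v'. subseq v' v \<and> v' \<noteq> [] \<and> walk (map fst v') \<and> distinct (map fst v')
    \<and> fst (hd v') = fst (hd v) \<and> fst (last v') = fst (last v)"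
  using assms
proof (induction "length v" arbitrary: v rule: less_induct)
  case less
  show ?case
  proof (cases "distinct (map fst v)")
    case True
    then show ?thesis using less.prems by blast
  next
    case False
    then obtain xs ys zs t where "map fst v = xs @ [t] @ ys @ [t] @ zs"
      using not_distinct_decomp by blast
    then obtain a m b m' c where v: "v = a @ [m] @ b @ [m'] @ c" "fst m = fst m'"
      by (fastforce simp: map_eq_append_conv map_eq_Cons_conv append_eq_map_conv Cons_eq_map_conv)
    let ?v = "a @ [m] @ c"
    have "successively (\<lambda>s t. t \<notin> star s) (map fst (a @ [m]) @ map fst (b @ m' # c))"
      "successively (\<lambda>s t. t \<notin> star s) (map fst (a @ [m] @ b) @ map fst (m' # c))"
      using less.prems(1) v(1) by (simp_all add: walk_def)
    then have "walk (map fst (a @ [m]))" "walk (map fst (m' # c))"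
      unfolding walk_def successively_append_iff[of _ "map fst _"] by simp_all
    then have "walk (map fst ?v)"
      using v(2) by (cases c) (auto simp: walk_def successively_append_iff)
    then obtain v' where "subseq v' ?v" "v' \<noteq> []" "walk (map fst v')" "distinct (map fst v')"
      "fst (hd v') = fst (hd ?v)" "fst (last v') = fst (last ?v)"
      using less.hyps[of ?v] v by auto
    moreover have "subseq ?v v" unfolding v(1)
      by (intro list_emb_append_mono subseq_order.refl) (auto intro: list_emb_append2)
    moreover have "fst (hd ?v) = fst (hd v)" "fst (last ?v) = fst (last v)"
      using v by (auto simp: hd_append)
    ultimately show ?thesis using subseq_order.trans[of _ ?v v] by (intro exI[of _ v']) simp
  qed
qed

text \<open>\<open>w\<close> is a shortest path between the two cosets. Its first letter lies
  outside the star of \<open>x\<close>, and no letter in the star of \<open>y\<close> can be moved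
  to its end; otherwise the letter could be absorbed into \<open>s\<close> or
  \<open>s'\<close>.\<close>

lemma separating_pattern:
  assumes "g \<in> words_over V" "h \<in> words_over V" "star x \<subseteq> V" "star y \<subseteq> V"
    and disjoint: "\<not> (\<exists>s\<in>words_over (star x). \<exists>s'\<in>words_over (star y). h @ s' \<approx> g @ s)"
  shows "\<exists>s s' w ts. s \<in> words_over (star x) \<and> s' \<in> words_over (star y) \<and> h @ s' \<approx> g @ s @ w
    \<and> ts \<noteq> [] \<and> walk ts \<and> distinct ts \<and> set ts \<subseteq> V \<and> hd ts \<notin> star x \<and> last ts \<notin> star y
    \<and> (\<exists>c. pattern_count ts (thicken c (g @ s) w) \<noteq> 0)"
proof -
  define D where "D w \<longleftrightarrow> (\<exists>s\<in>words_over (star x). \<exists>s'\<in>words_over (star y). h @ s' \<approx> g @ s @ w)" for w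
  have "D (inv_word g @ h)"
    unfolding D_def using req_cancel_left(1)[of g h]
    by (intro bexI[of _ "[]"]) (auto intro: req_sym)
  then obtain w where "D w" and least: "\<And>u. D u \<Longrightarrow> length w \<le> length u"
    using ex_has_least_nat[of D _ length] by blast
  then obtain s s' where s: "s \<in> words_over (star x)" "s' \<in> words_over (star y)" "h @ s' \<approx> g @ s @ w"
    by (auto simp: D_def)
  have "geodesic w"
    unfolding geodesic_def
  proof (intro allI impI)
    fix u assume "u \<approx> w"
    then have "h @ s' \<approx> g @ s @ u"
      using s(3) by (meson req_append req_refl req_sym req_trans)
    then show "length w \<le> length u" using s by (intro least) (auto simp: D_def)
  qed
  have "w \<in> words_over V"
  proof (rule geodesic_words_over[OF \<open>geodesic w\<close>])
    show "w \<approx> inv_word (g @ s) @ h @ s'"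
      using s(3) req_move_left[of "g @ s" w "h @ s'"] by (auto intro: req_sym)
    show "inv_word (g @ s) @ h @ s' \<in> words_over V"
      using assms(1-4) s(1,2) by (auto intro: words_over_mono)
  qed
  have "w \<noteq> []" using disjoint s by auto
  then obtain l0 w' where w: "w = l0 # w'" by (cases w) auto
  have l0: "fst l0 \<notin> star x"
  proof
    assume "fst l0 \<in> star x"
    then have "D w'"
      unfolding D_def using s w by (intro bexI[of _ "s @ [l0]"] bexI[of _ s']) auto
    then show False using least w by fastforce
  qed
  have "\<exists>v. subseq v w' \<and> walk (map fst (l0 # v)) \<and> fst (last (l0 # v)) \<notin> star y"
  proof (rule walk_to_star_exit, rule ccontr)
    fix u l v
    assume l: "l0 # w' = u @ l # v" "fst l \<in> star y" "\<not> (\<exists>m\<in>set v. fst m \<notin> star (fst l))"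
    have "v @ [l] \<approx> l # v" by (rule req_commute_star) (use l(3) in \<open>auto simp: words_over_def\<close>)
    then have "(g @ s @ u) @ v @ [l] \<approx> (g @ s @ u) @ l # v" by (rule req_append[OF req_refl])
    then have "h @ s' \<approx> (g @ s @ u @ v) @ [l]"
      using s(3) w l(1) by (auto intro: req_sym req_trans)
    then have "h @ s' @ inv_word [l] \<approx> g @ s @ u @ v"
      using req_move_right[of "g @ s @ u @ v" "[l]" "h @ s'"] by (auto intro: req_sym)
    then have "D (u @ v)"
      unfolding D_def using s l(2) by (intro bexI[of _ s] bexI[of _ "s' @ inv_word [l]"]) auto
    then show False using least[of "u @ v"] w l(1) by simp
  qed
  then obtain v where v: "subseq (l0 # v) w" "walk (map fst (l0 # v))" "fst (last (l0 # v)) \<notin> star y"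
    using w by auto
  obtain v' where v': "subseq v' (l0 # v)" "v' \<noteq> []" "walk (map fst v')" "distinct (map fst v')"
    "fst (hd v') = fst l0" "fst (last v') \<notin> star y"
    using distinct_subwalk[OF v(2)] v(3) by auto
  have "subseq v' w" using v'(1) v(1) by (rule subseq_order.trans)
  \<comment> \<open>Keeping exactly the hyperplanes of the walk turns \<open>w\<close> into
    \<open>v'\<close>, which contains its own pattern.\<close>
  then obtain K where "thicken (\<lambda>h. if h \<in> K then 1 else 0) (g @ s) w = v'"
    using thicken_subseq[OF geodesic_hyps_distinct[OF \<open>geodesic w\<close>]] by blast
  then have "\<exists>c. pattern_count (map fst v') (thicken c (g @ s) w) \<noteq> 0"
    using pattern_count_self by metis
  moreover have "set (map fst v') \<subseteq> V"
  proof -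
    have "set v' \<subseteq> set w" by (auto elim: list_emb_set[OF \<open>subseq v' w\<close>])
    then show ?thesis using \<open>w \<in> words_over V\<close> by (auto simp: words_over_def)
  qed
  ultimately show ?thesis
    using s v' l0 by (intro exI[of _ s] exI[of _ s'] exI[of _ w] exI[of _ "map fst v'"])
      (auto simp: hd_map last_map)
qed

text \<open>Image of the vertex under reweighting. Only the conjugator is thickened;
  \<open>x\<close> keeps exponent one, so the result is again a vertex.\<close>

definition thick_conj :: "('a \<times> 'a word set \<Rightarrow> nat) \<Rightarrow> 'a word \<Rightarrow> 'a \<Rightarrow> 'a word" where
  "thick_conj c g x = thicken c [] g @ [(x, True)] @ inv_word (thicken c [] g)"

lemma thick_conj_star:
  assumes "s \<in> words_over (star x)" "h \<approx> g @ s"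
  shows "thick_conj c h x \<approx> thick_conj c g x"
  unfolding thick_conj_def
proof (rule conj_star)
  show "thicken c g s \<in> words_over (star x)" by (rule thicken_words_over[OF assms(1)])
  show "thicken c [] h \<approx> thicken c [] g @ thicken c g s"
    using thicken_cong[OF assms(2), of c "[]"] by (simp add: thicken_append)
qed

text \<open>If the images commute, their cosets meet, so the thickened \<open>w\<close> lies in the
  product of the two star subgroups and its pattern count vanishes.\<close>

lemma separating_polynomial:
  assumes "finite V" "g \<in> words_over V" "h \<in> words_over V" "star x \<subseteq> V" "star y \<subseteq> V"
    and "\<not> (\<exists>s\<in>words_over (star x). \<exists>s'\<in>words_over (star y). h @ s' \<approx> g @ s)"
  shows "\<exists>L F. finite L \<and> multiaffine L (card V) F \<and> (\<exists>c. F c \<noteq> 0) \<and>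
    (\<forall>c. F c \<noteq> 0 \<longrightarrow> \<not> commutes E (thick_conj c g x) (thick_conj c h y))"
proof -
  obtain s s' w ts where s: "s \<in> words_over (star x)" "s' \<in> words_over (star y)" "h @ s' \<approx> g @ s @ w"
    and ts: "ts \<noteq> []" "walk ts" "distinct ts" "set ts \<subseteq> V" "hd ts \<notin> star x" "last ts \<notin> star y"
    and nz: "\<exists>c. pattern_count ts (thicken c (g @ s) w) \<noteq> 0"
    using separating_pattern[OF assms(2-6)] by blast
  let ?F = "\<lambda>c. pattern_count ts (thicken c (g @ s) w)"
  have "length ts \<le> card V" using ts(3,4) assms(1) by (metis card_mono distinct_card)
  then have "multiaffine (set (hyps (g @ s) w)) (card V) ?F"
    by (intro multiaffine.mono[OF multiaffine_pattern_count[OF ts(3)]]) auto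
  moreover have "\<not> commutes E (thick_conj c g x) (thick_conj c h y)" if "?F c \<noteq> 0" for c
  proof
    assume "commutes E (thick_conj c g x) (thick_conj c h y)"
    then obtain r r' where r: "r \<in> words_over (star x)" "r' \<in> words_over (star y)"
      "thicken c [] h @ r' \<approx> thicken c [] g @ r"
      using commuting_conjugates(2) unfolding thick_conj_def by blast
    let ?g = "thicken c [] g" and ?h = "thicken c [] h"
    let ?s = "thicken c g s" and ?s' = "thicken c h s'" and ?w = "thicken c (g @ s) w"
    have "?h @ ?s' \<approx> ?g @ ?s @ ?w" using thicken_cong[OF s(3), of c "[]"] by (simp add: thicken_append)
    then have "inv_word ?g @ ?h @ ?s' \<approx> ?s @ ?w" using req_move_left[of "inv_word ?g"] by simp
    then have "inv_word ?s @ inv_word ?g @ ?h @ ?s' \<approx> ?w"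
      using req_move_left[of "inv_word ?s"] by simp
    moreover have "?h \<approx> ?g @ r @ inv_word r'"
      using r(3) req_move_right[of ?h r' "?g @ r"] by simp
    then have "inv_word ?g @ ?h \<approx> r @ inv_word r'" using req_move_left[of "inv_word ?g"] by simp
    then have "inv_word ?s @ (inv_word ?g @ ?h) @ ?s' \<approx> inv_word ?s @ (r @ inv_word r') @ ?s'"
      by (rule req_context)
    ultimately have "?w \<approx> (inv_word ?s @ r) @ inv_word r' @ ?s'"
      by (auto intro: req_sym req_trans)
    moreover have "pattern_count ts ((inv_word ?s @ r) @ inv_word r' @ ?s') = 0"
      using ts r s by (intro pattern_count_star_product) (auto intro: thicken_words_over)
    ultimately show False using that pattern_count_cong[OF _ ts(2)] by metis
  qed
  ultimately show ?thesis using nz by (intro exI[of _ "set (hyps (g @ s) w)"] exI[of _ ?F]) auto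
qed

text \<open>Reweighting preserves adjacency for every choice of weights, so only the non-adjacent
  pairs impose conditions. There are at most \<open>card VD ^ 2\<close> of them, each given by a
  polynomial of degree at most \<open>card V\<close>.\<close>

lemma induced_in_bounded_ball:
  assumes V: "finite V" "\<And>x y. E x y \<Longrightarrow> x \<in> V \<and> y \<in> V"
    and VD: "finite VD" "induced_in_ext VD ED E (ext_vertex V E)"
    and bound: "card VD ^ 2 * card V \<le> R"
  shows "induced_in_ext VD ED E (ball_vertex V E R)"
proof -
  obtain f where f: "\<forall>a\<in>VD. ext_vertex V E (f a)"
    "\<forall>a\<in>VD. \<forall>b\<in>VD. a \<noteq> b \<longrightarrow> \<not> f a \<approx> f b"
    "\<forall>a\<in>VD. \<forall>b\<in>VD. a \<noteq> b \<longrightarrow> (ED a b \<longleftrightarrow> commutes E (f a) (f b))"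
    using VD(2) unfolding induced_in_ext_def by blast
  have "\<forall>a\<in>VD. \<exists>g x. geodesic g \<and> g \<in> words_over V \<and> x \<in> V \<and> f a \<approx> g @ [(x, True)] @ inv_word g"
  proof
    fix a assume "a \<in> VD"
    then obtain k x where k: "k \<in> words_over V" "x \<in> V" "f a \<approx> inv_word k @ [(x, True)] @ k"
      using f(1) by (auto simp: ext_vertex_def)
    obtain g where g: "geodesic g" "g \<approx> inv_word k" using geodesic_exists by blast
    then have "g \<in> words_over V" using geodesic_words_over[of g "inv_word k" V] k(1) by simp
    moreover have "inv_word k @ [(x, True)] @ inv_word (inv_word k) \<approx> g @ [(x, True)] @ inv_word g"
      using g(2) by (intro req_append req_inv) (auto intro: req_sym)
    ultimately show "\<exists>g x. geodesic g \<and> g \<in> words_over V \<and> x \<in> V \<and> f a \<approx> g @ [(x, True)] @ inv_word g"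
      using g k req_trans by (intro exI[of _ g] exI[of _ x]) auto
  qed
  then obtain g x where gx: "\<And>a. a \<in> VD \<Longrightarrow> geodesic (g a)" "\<And>a. a \<in> VD \<Longrightarrow> g a \<in> words_over V"
    "\<And>a. a \<in> VD \<Longrightarrow> x a \<in> V" "\<And>a. a \<in> VD \<Longrightarrow> f a \<approx> g a @ [(x a, True)] @ inv_word (g a)"
    by metis
  have star: "star (x a) \<subseteq> V" if "a \<in> VD" for a using gx(3)[OF that] V(2) by (auto simp: star_def)
  \<comment> \<open>Cosets of equal type that meet belong to the same vertex.\<close>
  have common: "f a \<approx> f b" if "a \<in> VD" "b \<in> VD" "x a = x b" "s \<in> words_over (star (x a))"
    "s' \<in> words_over (star (x b))" "g b @ s' \<approx> g a @ s" for a b s s'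
  proof -
    have "g b @ s' @ inv_word s' \<approx> (g a @ s) @ inv_word s'"
      using req_append[OF that(6) req_refl] by simp
    then have "g b \<approx> g a @ s @ inv_word s'"
      using req_cancel_right(1) req_sym req_trans by (metis append_assoc)
    then have "g b @ [(x a, True)] @ inv_word (g b) \<approx> g a @ [(x a, True)] @ inv_word (g a)"
      using that by (intro conj_star) auto
    then show ?thesis using gx(4)[OF that(1)] gx(4)[OF that(2)] that(3) by (metis req_sym req_trans)
  qed
  \<comment> \<open>Vertices whose types are neither equal nor adjacent never commute, whatever the
    weights; \<open>P\<close> holds the remaining non-adjacent pairs.\<close>
  define P where "P = {(a, b) \<in> VD \<times> VD. a \<noteq> b \<and> \<not> ED a b \<and> x a \<in> star (x b)}"
  have P: "P \<subseteq> VD \<times> VD" by (auto simp: P_def)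
  then have "finite P" using VD(1) by (meson finite_SigmaI finite_subset)
  have "\<forall>p\<in>P. \<exists>L F. finite L \<and> multiaffine L (card V) F \<and> (\<exists>c. F c \<noteq> 0) \<and>
    (\<forall>c. F c \<noteq> 0 \<longrightarrow> \<not> commutes E (thick_conj c (g (fst p)) (x (fst p))) (thick_conj c (g (snd p)) (x (snd p))))"
  proof
    fix p assume "p \<in> P"
    then obtain a b where p: "p = (a, b)" "a \<in> VD" "b \<in> VD" "a \<noteq> b" "\<not> ED a b" "x a \<in> star (x b)"
      by (auto simp: P_def)
    have "\<not> (\<exists>s\<in>words_over (star (x a)). \<exists>s'\<in>words_over (star (x b)). g b @ s' \<approx> g a @ s)"
    proof
      assume "\<exists>s\<in>words_over (star (x a)). \<exists>s'\<in>words_over (star (x b)). g b @ s' \<approx> g a @ s"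
      then obtain s s' where s: "s \<in> words_over (star (x a))" "s' \<in> words_over (star (x b))"
        "g b @ s' \<approx> g a @ s" by blast
      let ?k = "g a @ s"
      have "f a \<approx> ?k @ [(x a, True)] @ inv_word ?k"
        using gx(4)[OF p(2)] conj_star[OF s(1), of ?k "g a"] by (auto intro: req_sym req_trans)
      moreover have "f b \<approx> ?k @ [(x b, True)] @ inv_word ?k"
        using gx(4)[OF p(3)] conj_star[OF s(2) req_sym[OF s(3)]] by (auto intro: req_sym req_trans)
      moreover have "commutes E (?k @ [(x a, True)] @ inv_word ?k) (?k @ [(x b, True)] @ inv_word ?k)"
        unfolding commutes_conj using req_commute_star_letter[of "(x a, True)" "(x b, True)"] p(6)
        by (simp add: commutes_def)
      ultimately have "commutes E (f a) (f b)" using commutes_cong by blast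
      then show False using f(3) p by blast
    qed
    from separating_polynomial[OF V(1) gx(2)[OF p(2)] gx(2)[OF p(3)] star[OF p(2)] star[OF p(3)] this]
    show "\<exists>L F. finite L \<and> multiaffine L (card V) F \<and> (\<exists>c. F c \<noteq> 0) \<and>
      (\<forall>c. F c \<noteq> 0 \<longrightarrow> \<not> commutes E (thick_conj c (g (fst p)) (x (fst p))) (thick_conj c (g (snd p)) (x (snd p))))"
      by (simp add: p(1))
  qed
  from bchoice[OF this] obtain L where "\<forall>p\<in>P. \<exists>F. finite (L p) \<and> multiaffine (L p) (card V) F \<and> (\<exists>c. F c \<noteq> 0) \<and>
    (\<forall>c. F c \<noteq> 0 \<longrightarrow> \<not> commutes E (thick_conj c (g (fst p)) (x (fst p))) (thick_conj c (g (snd p)) (x (snd p))))" ..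
  from bchoice[OF this] obtain F where F: "\<forall>p\<in>P. finite (L p) \<and> multiaffine (L p) (card V) (F p) \<and> (\<exists>c. F p c \<noteq> 0) \<and>
    (\<forall>c. F p c \<noteq> 0 \<longrightarrow> \<not> commutes E (thick_conj c (g (fst p)) (x (fst p))) (thick_conj c (g (snd p)) (x (snd p))))" ..
  have "\<exists>c. (\<forall>h. h \<notin> \<Union>(L ` P) \<longrightarrow> c h = 0) \<and> (\<forall>p\<in>P. F p c \<noteq> 0) \<and> sum c (\<Union>(L ` P)) \<le> (\<Sum>p\<in>P. card V)"
  proof (rule multiaffine_nonvanishing)
    show "multiaffine (\<Union>(L ` P)) (card V) (F p)" if "p \<in> P" for p
      by (rule multiaffine.mono[of "L p" "card V"]) (use F that in auto)
  qed (use F \<open>finite P\<close> in auto)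
  then obtain c where c: "\<forall>h. h \<notin> \<Union>(L ` P) \<longrightarrow> c h = 0" "\<forall>p\<in>P. F p c \<noteq> 0"
    "sum c (\<Union>(L ` P)) \<le> (\<Sum>p\<in>P. card V)"
    by (elim exE conjE) (rule that)
  have "card P \<le> card VD ^ 2"
    using card_mono[OF _ P] VD(1) by (simp add: card_cartesian_product power2_eq_square)
  then have "card P * card V \<le> card VD ^ 2 * card V" by (rule mult_le_mono1)
  then have sum_R: "sum c (\<Union>(L ` P)) \<le> R"
    using c(3)[unfolded sum_constant of_nat_id] bound by (meson order_trans)
  define f' where "f' a = thick_conj c (g a) (x a)" for a
  have "ball_vertex V E R (f' a)" if a: "a \<in> VD" for a
  proof -
    let ?v = "thicken c [] (g a)"
    have "?v \<in> words_over V" using gx(2)[OF a] by (rule thicken_words_over)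
    then have "word_length V E ?v \<le> length ?v"
      unfolding word_length_def by (intro Least_le) auto
    \<comment> \<open>A geodesic crosses each hyperplane once, so each weight is counted
      once.\<close>
    also have "\<dots> = sum c (set (hyps [] (g a)))"
      using geodesic_hyps_distinct[OF gx(1)[OF a], of "[]"] by (simp add: length_thicken sum_list_distinct_conv_sum_set)
    also have "\<dots> = sum c (set (hyps [] (g a)) \<inter> \<Union>(L ` P))"
      by (intro sum.mono_neutral_right ballI) (use c(1) in blast)+
    also have "\<dots> \<le> sum c (\<Union>(L ` P))" using F \<open>finite P\<close> by (intro sum_mono2) auto
    also have "\<dots> \<le> R" by (rule sum_R)
    finally show ?thesis
      using \<open>?v \<in> words_over V\<close> gx(3)[OF a] unfolding ball_vertex_def f'_def thick_conj_def
      by (intro bexI[of _ ?v] bexI[of _ "x a"]) auto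
  qed
  moreover have "\<not> f' a \<approx> f' b \<and> (ED a b \<longleftrightarrow> commutes E (f' a) (f' b))"
    if ab: "a \<in> VD" "b \<in> VD" "a \<noteq> b" for a b
  proof (cases "ED a b")
    case True
    then have "commutes E (f a) (f b)" using f(3) ab by blast
    then have comm: "commutes E (g a @ [(x a, True)] @ inv_word (g a)) (g b @ [(x b, True)] @ inv_word (g b))"
      using commutes_cong gx(4) ab by blast
    then obtain s s' where s: "s \<in> words_over (star (x a))" "s' \<in> words_over (star (x b))"
      "g b @ s' \<approx> g a @ s" using commuting_conjugates(2) by blast
    \<comment> \<open>Adjacent vertices have distinct types, so exponent sums keep their images
      distinct.\<close>
    have "x a \<noteq> x b" using common[OF ab(1,2) _ s] f(2) ab by blast
    then have "pattern_count [x a] (f' a) \<noteq> pattern_count [x a] (f' b)"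
      by (simp add: f'_def thick_conj_def)
    then have "\<not> f' a \<approx> f' b" using pattern_count_cong[of "f' a" "f' b" "[x a]"] by (auto simp: walk_def)
    moreover have "commutes E (f' a) (f' b)"
    proof -
      have "f' a \<approx> thick_conj c (g a @ s) (x a)"
        unfolding f'_def using thick_conj_star[OF s(1) req_refl] by (rule req_sym)
      moreover have "f' b \<approx> thick_conj c (g a @ s) (x b)"
        unfolding f'_def using thick_conj_star[OF s(2) req_sym[OF s(3)]] by (rule req_sym)
      moreover have "commutes E (thick_conj c (g a @ s) (x a)) (thick_conj c (g a @ s) (x b))"
        unfolding thick_conj_def commutes_conj
        using req_commute_star_letter[of "(x a, True)" "(x b, True)"] commuting_conjugates(1)[OF comm]
        by (simp add: commutes_def)
      ultimately show ?thesis using commutes_cong by blast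
    qed
    ultimately show ?thesis using True by blast
  next
    case False
    have nc: "\<not> commutes E (f' a) (f' b)"
    proof (cases "x a \<in> star (x b)")
      case True
      then have "(a, b) \<in> P" using ab False by (simp add: P_def)
      then show ?thesis using F c(2) unfolding f'_def by fastforce
    next
      case False
      then show ?thesis using commuting_conjugates(1) unfolding f'_def thick_conj_def by blast
    qed
    \<comment> \<open>Equal images would commute, so injectivity on non-adjacent pairs follows from
      non-commutation.\<close>
    moreover have "\<not> f' a \<approx> f' b"
    proof
      assume "f' a \<approx> f' b"
      then have "commutes E (f' a) (f' b)" using commutes_cong[of "f' a" "f' b" "f' b" "f' b"]
        by (simp add: commutes_def)
      then show False using nc by blast
    qed
    ultimately show ?thesis using False by blast
  qed
  ultimately show ?thesis unfolding induced_in_ext_def by blast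
qed

end

section \<open>Comparison with the stated radius\<close>

lemma num_components_pos:
  assumes "finite V" "V \<noteq> {}"
  shows "num_components V E \<ge> 1"
proof -
  let ?r = "{(a, b). a \<in> V \<and> b \<in> V \<and> (\<lambda>x y. x \<in> V \<and> y \<in> V \<and> E x y)\<^sup>*\<^sup>* a b}"
  have "V // ?r = (\<lambda>a. ?r `` {a}) ` V" by (auto simp: quotient_def)
  then show ?thesis
    using assms unfolding num_components_def by (simp add: Suc_le_eq card_gt_0_iff)
qed

theorem theorem3p1:
  fixes VD :: "'b set" and ED :: "'b \<Rightarrow> 'b \<Rightarrow> bool"
    and VG :: "'a set" and EG :: "'a \<Rightarrow> 'a \<Rightarrow> bool"
  assumes "simple_graph VD ED" and "simple_graph VG EG"
    and "induced_in_ext VD ED EG (ext_vertex VG EG)"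
  shows "induced_in_ext VD ED EG
           (ball_vertex VG EG (4 * num_components VD ED * (card VD)^2 * (card VG)^(num_components VD ED + 1)))"
proof (cases "VD = {}")
  case True
  then show ?thesis by (simp add: induced_in_ext_def)
next
  case False
  interpret commutation_graph EG
    using assms(2) unfolding simple_graph_def by unfold_locales blast+
  let ?K = "num_components VD ED"
  have fin: "finite VD" "finite VG" and EG: "\<And>x y. EG x y \<Longrightarrow> x \<in> VG \<and> y \<in> VG"
    using assms(1,2) by (auto simp: simple_graph_def)
  obtain a where "a \<in> VD" using False by blast
  \<comment> \<open>The image of \<open>a\<close> is a conjugate of some generator, so
    \<open>card VG \<ge> 1\<close> and its powers do not decrease.\<close>
  then have "VG \<noteq> {}" using assms(3) by (auto simp: induced_in_ext_def ext_vertex_def)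
  then have "card VG ^ 1 \<le> card VG ^ (?K + 1)"
    using fin by (intro power_increasing) (auto simp: Suc_le_eq card_gt_0_iff)
  moreover have "?K \<ge> 1" using num_components_pos[OF fin(1) False] .
  then have "1 * card VD ^ 2 \<le> 4 * ?K * card VD ^ 2" by (intro mult_le_mono1) simp
  ultimately have "card VD ^ 2 * card VG \<le> 4 * ?K * card VD ^ 2 * card VG ^ (?K + 1)"
    using mult_le_mono[of "card VD ^ 2" "4 * ?K * card VD ^ 2" "card VG" "card VG ^ (?K + 1)"] by simp
  then show ?thesis using induced_in_bounded_ball[OF fin(2) EG fin(1) assms(3)] by blast
qed

end
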